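(* Consider $N$ agents with linear dynamics $\dot x_i=A_ix_i+B_iu_i$, $y_i=C_ix_i$ ($i=1,\dots,N$), satisfying the standing assumptions (A1)–(A4) of the context. Let $\varepsilon>0$, $K_\mu>0$, $\sigma>0$, $\iota>0$, and let every agent apply the event-triggered controller $$u_i=-K_{\alpha_i}x_i+K_{\beta_i}\,\Pi_{\mathcal Y_i}\big[y_i,-\varepsilon \mathcal H_i^{y_i}(t,y_i,\mu_i)\big],\qquad \dot\mu_i=\Pi_{\mathbb R_+^q}\Big[\mu_i,\ \varepsilon g_i(t,y_i)-2\varepsilon K_\mu\sum_{j=1}^N a_{ij}\,\mathrm{sgn}(\hat\mu_i-\hat\mu_j)\Big],\qquad \mu_i(0)=\mathbf 0,$$ where $\hat\mu_i(t)=\mu_i(t_i^l)$ for $t\in[t_i^l,t_i^{l+1})$, $e_i(t)=\hat\mu_i(t)-\mu_i(t)$, and the communication instants of agent $i$ are generated by $$t_i^{l+1}=\inf_{t>t_i^l}\Big\{t\ \Big|\ \|e_i(t)\|\ge \frac{1}{6N\sqrt q}\sum_{j=1}^N a_{ij}\|\hat\mu_i-\hat\mu_j\|_1+\frac{\sigma e^{-\iota t}}{3N^2K_\mu\sqrt q}\Big\}.$$ Then the closed-loop system does not exhibit Zeno behavior: for every agent $i$ and every finite horizon $T$, only finitely many communication instants $t_i^l$ lie in $[0,T]$.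
   Context: Agent $i$ has state $x_i\in\mathbb R^{n_i}$, input $u_i\in\mathbb R^{m_i}$, output $y_i\in\mathbb R^{p_i}$, with real matrices $A_i,B_i,C_i$ of compatible sizes; an output set $\mathcal Y_i\subseteq\mathbb R^{p_i}$; a cost function $f_i(t,\cdot):\mathbb R^{p_i}\to\mathbb R$; and a constraint function $g_i(t,\cdot):\mathbb R^{p_i}\to\mathbb R^q$ with components $g_{i,1},\dots,g_{i,q}$. Write $\mathcal Y=\mathcal Y_1\times\cdots\times\mathcal Y_N$. Norm $\|\cdot\|$ is Euclidean and $\|\cdot\|_1$ is the 1-norm; vector inequalities are componentwise; $\mathbb R^q_+$ is the nonnegative orthant. Standing assumptions (with $T$ the horizon considered). (A1) The communication graph on $\{1,\dots,N\}$ is undirected and connected; $a_{ij}=a_{ji}=1$ if $\{i,j\}$ is an edge and $a_{ij}=0$ otherwise. (A2) Each $\mathcal Y_i$ is convex and compact; for $t\in[0,T]$, $f_i(t,\cdot)$ and (componentwise) $g_i(t,\cdot)$ are convex and bounded on $\mathcal Y_i$ with $|f_i(t,y_i)|\le K_f$ and $\|g_i(t,y_i)\|\le K_g$ for constants $K_f,K_g>0$, and they are integrable in time (also along the trajectories considered). (A3) The set $\{y\in\mathcal Y:\ \sum_{i=1}^N g_i(t,y_i)\le \mathbf 0\ \text{for all } t\in[0,T]\}$ is nonempty. (A4) $(A_i,B_i)$ is controllable and $\mathrm{rank}(C_iB_i)=p_i$ for each $i$. Feedback matrices: $K_{\alpha_i},K_{\beta_i}$ are any solutions of $C_iB_iK_{\alpha_i}=C_iA_i$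 and $C_iB_iK_{\beta_i}=I_{p_i}$ (solutions exist by (A4)). Projection: for a closed convex set $\mathcal S\subseteq\mathbb R^n$, $x\in\mathcal S$, $v\in\mathbb R^n$, $\Pi_{\mathcal S}[x,v]=\lim_{\xi\to0^+}\frac{P_{\mathcal S}(x+\xi v)-x}{\xi}$, where $P_{\mathcal S}$ is Euclidean projection onto $\mathcal S$. Each agent has a multiplier $\mu_i\in\mathbb R^q_+$. $\mathcal H_i^{y_i}(t,y_i,\mu_i)$ denotes an element of $\partial f_i(t,y_i)+\sum_{k=1}^q\mu_{i,k}\,\partial g_{i,k}(t,y_i)$. In the controller $\mathrm{sgn}$ acts componentwise with $\mathrm{sgn}(s)=-1,0,1$ for $s<0$, $s=0$, $s>0$ respectively. Communication: agent $i$ has communication instants $t_i^1<t_i^2<\cdots$ with $t_i^1=0$ (and $t_i^{l+1}=\infty$ if the triggering set is empty); $\hat\mu_i$ is the last broadcast value of $\mu_i$. Trajectories are absolutely continuous functions $(x_i,\mu_i)$ satisfying the closed-loop equations for almost every $t$, with $y_i(t)\in\mathcal Y_i$ (in particular $y_i(0)\in\mathcal Y_i$) and $\mu_i(t)\in\mathbb R^q_+$. *)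

theory Defs
  imports "HOL-Analysis.Analysis"
begin

text \<open>
  The agents may have different state, input and output dimensions. The dimensions of agent
  \<open>i\<close> are given by finite index sets \<open>S i\<close>, \<open>U i\<close>, \<open>P i\<close> inside common finite index types:
  the space of real vectors indexed by \<open>S i\<close> is the coordinate subspace of vectors that vanish
  outside \<open>S i\<close>, of dimension \<open>card (S i)\<close>, and a matrix of agent \<open>i\<close> is padded with zeros
  outside its rows and columns. Sums, products, norms, ranks, convexity, compactness and closest
  points are unaffected by the padding. Since the index types are arbitrary, every finite family
  of dimensions is covered.
\<close>

definition coord_space :: "'n set \<Rightarrow> (real ^ 'n) set" where
  "coord_space S = {x. \<forall>k. k \<notin> S \<longrightarrow> x $ k = 0}"

definition coord_matrices :: "'m set \<Rightarrow> 'n set \<Rightarrow> (real ^ 'n ^ 'm) set" where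
  "coord_matrices R S = {A. \<forall>r s. \<not> (r \<in> R \<and> s \<in> S) \<longrightarrow> A $ r $ s = 0}"

definition coord_identity :: "'n set \<Rightarrow> real ^ 'n ^ 'n" where
  "coord_identity S = (\<chi> r s. if r = s \<and> r \<in> S then 1 else 0)"

definition controllable ::
    "'n set \<Rightarrow> 'm set \<Rightarrow> real ^ 'n ^ 'n \<Rightarrow> real ^ 'm ^ 'n \<Rightarrow> bool" where
  "controllable S U A B \<longleftrightarrow>
     (\<forall>x0\<in>coord_space S. \<forall>x1\<in>coord_space S. \<exists>T>0. \<exists>u x.
        continuous_on {0..T} u \<and> (\<forall>t\<in>{0..T}. u t \<in> coord_space U) \<and>
        (\<forall>t\<in>{0..T}. (x has_vector_derivative A *v x t + B *v u t) (at t within {0..T})) \<and>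
        x 0 = x0 \<and> x T = x1)"

definition adjacency :: "('v \<times> 'v) set \<Rightarrow> 'v \<Rightarrow> 'v \<Rightarrow> real" where
  "adjacency E i j = (if (i, j) \<in> E then 1 else 0)"

definition norm1 :: "real ^ 'n \<Rightarrow> real" where
  "norm1 x = (\<Sum>k\<in>UNIV. \<bar>x $ k\<bar>)"

text \<open>The library's \<open>sgn\<close> on vectors is normalisation, not the componentwise sign.\<close>

definition sgn_vec :: "real ^ 'n \<Rightarrow> real ^ 'n" where
  "sgn_vec x = (\<chi> k. sgn (x $ k))"

definition nonneg_orthant :: "(real ^ 'n) set" where
  "nonneg_orthant = {x. 0 \<le> x}"

definition proj_dir :: "(real ^ 'n) set \<Rightarrow> real ^ 'n \<Rightarrow> real ^ 'n \<Rightarrow> real ^ 'n" where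
  "proj_dir S x v =
     Lim (at_right 0) (\<lambda>\<xi>. (closest_point S (x + \<xi> *\<^sub>R v) - x) /\<^sub>R \<xi>)"

text \<open>
  Subdifferential at \<open>x\<close> of a function that is convex on \<open>Y\<close>, within the coordinate
  subspace indexed by \<open>P\<close>. It contains every subgradient of a convex function on the whole
  subspace.
\<close>

definition subdifferential ::
    "'p set \<Rightarrow> (real ^ 'p) set \<Rightarrow> (real ^ 'p \<Rightarrow> real) \<Rightarrow> real ^ 'p \<Rightarrow> (real ^ 'p) set" where
  "subdifferential P Y f x = {h \<in> coord_space P. \<forall>z\<in>Y. f z \<ge> f x + h \<bullet> (z - x)}"

definition lagrangian_subgradients ::
    "'p set \<Rightarrow> (real ^ 'p) set \<Rightarrow> (real ^ 'p \<Rightarrow> real) \<Rightarrow> (real ^ 'p \<Rightarrow> real ^ 'q) \<Rightarrow>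
     real ^ 'p \<Rightarrow> real ^ 'q \<Rightarrow> (real ^ 'p) set" where
  "lagrangian_subgradients P Y f g y \<mu> =
     {a + (\<Sum>k\<in>UNIV. (\<mu> $ k) *\<^sub>R b k) | a b.
        a \<in> subdifferential P Y f y \<and>
        (\<forall>k. b k \<in> subdifferential P Y (\<lambda>z. g z $ k) y)}"

definition abs_continuous_on :: "real set \<Rightarrow> (real \<Rightarrow> 'a::real_normed_vector) \<Rightarrow> bool" where
  "abs_continuous_on S f \<longleftrightarrow>
     (\<forall>e>0. \<exists>d>0. \<forall>D. D division_of \<Union>D \<and> \<Union>D \<subseteq> S \<and> (\<Sum>K\<in>D. Sup K - Inf K) < d \<longrightarrow>
        (\<Sum>K\<in>D. norm (f (Sup K) - f (Inf K))) < e)"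

definition locally_abs_continuous_on ::
    "real set \<Rightarrow> (real \<Rightarrow> 'a::real_normed_vector) \<Rightarrow> bool" where
  "locally_abs_continuous_on J f \<longleftrightarrow>
     (\<forall>a b. {a..b} \<subseteq> J \<longrightarrow> abs_continuous_on {a..b} f)"

text \<open>
  Triggering condition of agent \<open>i\<close> at time \<open>t\<close> when \<open>m\<close> is the value it broadcast last.
  The candidate next instant is determined with \<open>m\<close> kept fixed, i.e. with the measurement
  error before the reset caused by the broadcast at that instant.
\<close>

definition triggered ::
    "('v::finite \<times> 'v) set \<Rightarrow> real \<Rightarrow> real \<Rightarrow> real \<Rightarrow> ('v \<Rightarrow> real \<Rightarrow> real ^ 'q) \<Rightarrow>
     ('v \<Rightarrow> real \<Rightarrow> real ^ 'q) \<Rightarrow> 'v \<Rightarrow> real ^ 'q \<Rightarrow> real \<Rightarrow> bool" where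
  "triggered E K\<mu> \<sigma> \<iota> \<mu> \<mu>hat i m t \<longleftrightarrow>
     norm (m - \<mu> i t) \<ge>
       1 / (6 * real CARD('v) * sqrt (real CARD('q))) *
         (\<Sum>j\<in>UNIV. adjacency E i j * norm1 (m - \<mu>hat j t)) +
       \<sigma> * exp (- \<iota> * t) / (3 * (real CARD('v))\<^sup>2 * K\<mu> * sqrt (real CARD('q)))"

text \<open>
  \<open>\<tau> i l\<close> is the communication instant number \<open>l + 1\<close> of agent \<open>i\<close>, for a trajectory with time
  domain \<open>J\<close>; the infimum of the empty set in \<^typ>\<open>ereal\<close> is \<open>\<infinity>\<close>. If the instants of an
  agent accumulate, its broadcast value from the accumulation point on is left arbitrary.
\<close>

definition event_triggered ::
    "real set \<Rightarrow> ('v::finite \<times> 'v) set \<Rightarrow> real \<Rightarrow> real \<Rightarrow> real \<Rightarrow>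
     ('v \<Rightarrow> real \<Rightarrow> real ^ 'q) \<Rightarrow> ('v \<Rightarrow> real \<Rightarrow> real ^ 'q) \<Rightarrow> ('v \<Rightarrow> nat \<Rightarrow> ereal) \<Rightarrow> bool"
where
  "event_triggered J E K\<mu> \<sigma> \<iota> \<mu> \<mu>hat \<tau> \<longleftrightarrow>
     (\<forall>i. \<tau> i 0 = 0) \<and>
     (\<forall>i l. \<tau> i (Suc l) =
        Inf {ereal t | t. t \<in> J \<and> \<tau> i l < ereal t \<and>
               triggered E K\<mu> \<sigma> \<iota> \<mu> \<mu>hat i (\<mu> i (real_of_ereal (\<tau> i l))) t}) \<and>
     (\<forall>i l. \<forall>t\<in>J. \<tau> i l \<le> ereal t \<and> ereal t < \<tau> i (Suc l) \<longrightarrow>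
        \<mu>hat i t = \<mu> i (real_of_ereal (\<tau> i l)))"

end

theory Submission
  imports Defs
begin

text \<open>
  The projected multiplier dynamics are bounded on \<open>[0, T]\<close>, whatever the broadcast values, so an
  absolutely continuous multiplier is Lipschitz there, with some constant \<open>M\<close>. A trigger before
  \<open>T\<close> needs an error of at least \<open>c exp (- \<iota> T)\<close> for a constant \<open>c > 0\<close>, hence consecutive instants before \<open>T\<close> are at least
  \<open>c exp (- \<iota> T) / M\<close> apart. This leaves the case of instants stuck at \<open>T\<close> itself because
  triggers accumulate there from the right, where the bound on \<open>g\<close> is not available; it is excluded
  by right continuity of the multiplier.
\<close>

section \<open>Mean value inequality for absolutely continuous functions\<close>

text \<open>
  A gauge argument: the intervals tagged in the exceptional null set lie in an open set of small
  measure, so absolute continuity makes their contribution small; on each of the others the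
  derivative bound at the tag applies.
\<close>

lemma abs_continuous_imp_norm_diff_le:
  fixes F :: "real \<Rightarrow> 'a::real_normed_vector"
  assumes ac: "abs_continuous_on {a..b} F" and "a \<le> b" and "0 \<le> M"
    and deriv: "AE t in lebesgue. t \<in> {a..b} \<longrightarrow>
      (\<exists>D. (F has_vector_derivative D) (at t within {a..b}) \<and> norm D \<le> M)"
  shows "norm (F b - F a) \<le> M * (b - a)"
proof (rule field_le_epsilon)
  fix e :: real
  assume "e > 0"
  \<comment> \<open>The error \<open>e\<close> is split in two: a slope excess \<open>e1\<close>
    over the length \<open>b - a\<close>, and \<open>e1\<close> for the intervals tagged in the null
    set. The summand 1 keeps the denominator positive when \<open>a = b\<close>.\<close>
  define e1 where "e1 = e / (b - a + 1)"
  have e1: "e1 > 0" "e1 * (b - a) + e1 = e"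
    using \<open>e > 0\<close> \<open>a \<le> b\<close> by (auto simp: e1_def field_simps add_divide_distrib[symmetric])
  obtain N where N: "N \<in> null_sets lebesgue"
    and outside: "\<And>t. t \<in> space lebesgue - N \<Longrightarrow> t \<in> {a..b} \<longrightarrow>
      (\<exists>D. (F has_vector_derivative D) (at t within {a..b}) \<and> norm D \<le> M)"
    by (rule AE_E3[OF deriv]) blast
  have der: "\<exists>D. (F has_vector_derivative D) (at t within {a..b}) \<and> norm D \<le> M"
    if "t \<in> {a..b}" "t \<notin> N" for t
    using outside[of t] that by simp
  obtain d where "d > 0" and d: "\<And>\<D>. \<lbrakk>\<D> division_of \<Union>\<D>; \<Union>\<D> \<subseteq> {a..b};
      (\<Sum>K\<in>\<D>. Sup K - Inf K) < d\<rbrakk> \<Longrightarrow> (\<Sum>K\<in>\<D>. norm (F (Sup K) - F (Inf K))) < e1"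
    using ac e1 unfolding abs_continuous_on_def by meson
  \<comment> \<open>Outer regularity, with \<open>d\<close> the length that absolute continuity
    allows for the tolerance \<open>e1\<close>.\<close>
  obtain G where G: "open G" "N \<subseteq> G" "G - N \<in> lmeasurable" "emeasure lebesgue (G - N) < ennreal d"
    using sets_lebesgue_outer_open[OF null_setsD2[OF N] \<open>d > 0\<close>] by blast
  have Gm: "G \<in> lmeasurable" "measure lebesgue G < d"
  proof -
    have "G = (G - N) \<union> N"
      using G(2) by blast
    moreover have "N \<in> lmeasurable" "measure lebesgue N = 0"
      using N by (auto simp: negligible_iff_null_sets[symmetric] negligible_imp_measurable
          negligible_imp_measure0)
    ultimately show "G \<in> lmeasurable"
      using G(3) by (metis fmeasurable.Un)
    have "measure lebesgue G = measure lebesgue (G - N)"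
      using N \<open>G \<in> lmeasurable\<close> by (simp add: fmeasurableD measure_Diff_null_set)
    also have "\<dots> < d"
      using G(3,4) \<open>d > 0\<close> by (simp add: emeasure_eq_measure2 ennreal_less_iff)
    finally show "measure lebesgue G < d" .
  qed
  \<comment> \<open>The gauge radius at \<open>t\<close>. At a regular tag the estimate covers
    \<open>s\<close> on both sides of \<open>t\<close>, since a tag may lie anywhere in its
    interval.\<close>
  have "\<exists>r>0. (t \<in> N \<longrightarrow> ball t r \<subseteq> G) \<and> (t \<in> {a..b} - N \<longrightarrow>
      (\<forall>s\<in>{a..b}. \<bar>s - t\<bar> < r \<longrightarrow> norm (F s - F t) \<le> (M + e1) * \<bar>s - t\<bar>))" for t
  proof (cases "t \<in> N")
    case True
    then show ?thesis
      using G(1,2) by (metis DiffE open_contains_ball subsetD)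
  next
    case False
    show ?thesis
    proof (cases "t \<in> {a..b}")
      case True
      then obtain D where D: "(F has_vector_derivative D) (at t within {a..b})" "norm D \<le> M"
        using der False by blast
      then obtain r where "r > 0" and r: "\<And>s. \<lbrakk>s \<in> {a..b}; \<bar>s - t\<bar> < r\<rbrakk> \<Longrightarrow>
          norm (F s - F t - (s - t) *\<^sub>R D) \<le> e1 * \<bar>s - t\<bar>"
        using \<open>e1 > 0\<close> unfolding has_vector_derivative_def has_derivative_within_alt real_norm_def
        by blast
      have "norm (F s - F t) \<le> (M + e1) * \<bar>s - t\<bar>" if "s \<in> {a..b}" "\<bar>s - t\<bar> < r" for s
      proof -
        have "norm (F s - F t) \<le> norm (F s - F t - (s - t) *\<^sub>R D) + norm ((s - t) *\<^sub>R D)"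
          by (metis diff_add_cancel norm_triangle_ineq)
        also have "\<dots> \<le> e1 * \<bar>s - t\<bar> + \<bar>s - t\<bar> * M"
          using r[OF that] D(2) by (auto intro!: add_mono mult_left_mono)
        finally show ?thesis
          by (simp add: algebra_simps)
      qed
      then show ?thesis
        using \<open>r > 0\<close> False by auto
    qed (use False in \<open>auto intro: zero_less_one\<close>)
  qed
  then obtain r where r_pos: "\<And>t. r t > 0"
    and r_null: "\<And>t. t \<in> N \<Longrightarrow> ball t (r t) \<subseteq> G"
    and r_der: "\<And>t s. \<lbrakk>t \<in> {a..b}; t \<notin> N; s \<in> {a..b}; \<bar>s - t\<bar> < r t\<rbrakk> \<Longrightarrow>
      norm (F s - F t) \<le> (M + e1) * \<bar>s - t\<bar>"
    by (metis DiffI)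
  obtain p where p: "p tagged_division_of {a..b}" and fine: "(\<lambda>t. ball t (r t)) fine p"
    using fine_division_exists_real[of "\<lambda>t. ball t (r t)" a b] r_pos gauge_ball_dependent by blast
  have fin: "finite p"
    using p by blast
  have pK: "\<exists>u v. K = {u..v} \<and> u \<le> v \<and> t \<in> {u..v} \<and> {u..v} \<subseteq> {a..b} \<and> {u..v} \<subseteq> ball t (r t)"
    if tK: "(t, K) \<in> p" for t K
  proof -
    obtain u v where "K = cbox u v"
      using tagged_division_ofD(4)[OF p tK] by blast
    then show ?thesis
      using tagged_division_ofD(2,3)[OF p tK] fineD[OF fine tK] by (auto intro!: exI[of _ u] exI[of _ v])
  qed
  define p1 where "p1 = {tK \<in> p. fst tK \<in> N}"
  \<comment> \<open>The guard is needed because \<open>Sup {}\<close> and \<open>Inf {}\<close> are unspecified reals.\<close>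
  define h where "h K = (if K = {} then 0 else norm (F (Sup K) - F (Inf K)))" for K
  \<comment> \<open>The intervals with null tags need not fill \<open>{a..b}\<close>, but they
    divide their own union, which is the form absolute continuity accepts.\<close>
  have p1: "p1 tagged_division_of \<Union>(snd ` p1)"
    using p tagged_partial_division_subset[of p "{a..b}" p1] tagged_partial_division_of_Union_self
    unfolding p1_def tagged_division_of_def by blast
  have div: "snd ` p1 division_of \<Union>(snd ` p1)"
    by (rule division_of_tagged_division[OF p1])
  have p1K: "\<exists>u v. K = {u..v} \<and> u \<le> v \<and> {u..v} \<subseteq> {a..b} \<and> {u..v} \<subseteq> G" if K: "K \<in> snd ` p1" for K
  proof -
    obtain t where "(t, K) \<in> p" "t \<in> N"
      using K by (auto simp: p1_def)
    then show ?thesis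
      using pK r_null by (meson order_trans)
  qed
  have null_part: "(\<Sum>(t, K)\<in>p1. norm (F (Sup K) - F (Inf K))) < e1"
  proof -
    have "(\<Sum>K\<in>snd ` p1. Sup K - Inf K) = (\<Sum>K\<in>snd ` p1. measure lebesgue K)"
      by (rule sum.cong[OF refl]) (auto dest!: p1K)
    also have "\<dots> = measure lebesgue (\<Union>(snd ` p1))"
      by (rule content_division[OF div])
    also have "\<dots> \<le> measure lebesgue G"
    proof (rule measure_mono_fmeasurable)
      show "\<Union>(snd ` p1) \<subseteq> G"
        by (metis Sup_least p1K)
      show "\<Union>(snd ` p1) \<in> sets lebesgue"
        using lmeasurable_division[OF div] by auto
    qed (rule Gm)
    finally have "(\<Sum>K\<in>snd ` p1. Sup K - Inf K) < d"
      using Gm by simp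
    moreover have "\<Union>(snd ` p1) \<subseteq> {a..b}"
      by (metis Sup_least p1K)
    ultimately have "(\<Sum>K\<in>snd ` p1. norm (F (Sup K) - F (Inf K))) < e1"
      using d div by blast
    moreover have "(\<Sum>(t, K)\<in>p1. norm (F (Sup K) - F (Inf K))) = (\<Sum>(t, K)\<in>p1. h K)"
      by (rule sum.cong[OF refl]) (auto simp: h_def p1_def dest!: pK)
    \<comment> \<open>Two tags share an interval only if its interior is empty. It is then empty or
      a point, where \<open>h\<close> vanishes, so summing over pairs or over intervals gives the
      same value.\<close>
    moreover have "(\<Sum>(t, K)\<in>p1. h K) = (\<Sum>K\<in>snd ` p1. h K)"
      by (rule sum.over_tagged_division_lemma[OF p1]) (auto simp: h_def)
    moreover have "(\<Sum>K\<in>snd ` p1. h K) = (\<Sum>K\<in>snd ` p1. norm (F (Sup K) - F (Inf K)))"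
      by (rule sum.cong[OF refl]) (auto simp: h_def dest!: p1K)
    ultimately show ?thesis
      by simp
  qed
  have len: "(\<Sum>(t, K)\<in>p. Sup K - Inf K) = b - a"
    by (rule additive_tagged_division_1[OF \<open>a \<le> b\<close> p])
  have "norm (F b - F a) = norm (\<Sum>(t, K)\<in>p. F (Sup K) - F (Inf K))"
    using additive_tagged_division_1[OF \<open>a \<le> b\<close> p, of F] by simp
  also have "\<dots> \<le> (\<Sum>(t, K)\<in>p. norm (F (Sup K) - F (Inf K)))"
    by (rule sum_norm_le) auto
  also have "\<dots> = (\<Sum>(t, K)\<in>p - p1. norm (F (Sup K) - F (Inf K))) +
      (\<Sum>(t, K)\<in>p1. norm (F (Sup K) - F (Inf K)))"
    by (rule sum.subset_diff) (auto simp: fin p1_def)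
  also have "\<dots> \<le> (\<Sum>(t, K)\<in>p - p1. (M + e1) * (Sup K - Inf K)) + e1"
  proof (intro add_mono sum_mono)
    fix tK
    assume "tK \<in> p - p1"
    then obtain t K where tK: "tK = (t, K)" "(t, K) \<in> p" "t \<notin> N"
      by (cases tK) (auto simp: p1_def)
    obtain u v where uv: "K = {u..v}" "u \<le> v" "t \<in> {u..v}" "{u..v} \<subseteq> {a..b}"
      "{u..v} \<subseteq> ball t (r t)"
      using pK[OF tK(2)] by blast
    then have "u \<in> {u..v}" "v \<in> {u..v}"
      by auto
    then have "u \<in> ball t (r t)" "v \<in> ball t (r t)" "u \<in> {a..b}" "v \<in> {a..b}" "t \<in> {a..b}"
      using uv by blast+
    then have "norm (F v - F t) \<le> (M + e1) * \<bar>v - t\<bar>" "norm (F u - F t) \<le> (M + e1) * \<bar>u - t\<bar>"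
      using r_der tK(3) by (auto simp: dist_real_def)
    \<comment> \<open>Splitting at the tag loses no length: \<open>t\<close> lies between
      \<open>u\<close> and \<open>v\<close>, so its distances to them add up to
      \<open>v - u\<close>.\<close>
    moreover have "norm (F v - F u) \<le> norm (F v - F t) + norm (F u - F t)"
      using norm_triangle_ineq4[of "F v - F t" "F u - F t"] by simp
    ultimately have "norm (F v - F u) \<le> (M + e1) * (v - u)"
      using uv(3) by (simp add: algebra_simps)
    then show "(case tK of (t, K) \<Rightarrow> norm (F (Sup K) - F (Inf K))) \<le>
        (case tK of (t, K) \<Rightarrow> (M + e1) * (Sup K - Inf K))"
      using tK uv by simp
  qed (use null_part in simp)
  \<comment> \<open>The intervals with null tags are put back, with nonnegative terms, so that all
    lengths sum to \<open>b - a\<close>.\<close>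
  also have "(\<Sum>(t, K)\<in>p - p1. (M + e1) * (Sup K - Inf K)) \<le>
      (\<Sum>(t, K)\<in>p. (M + e1) * (Sup K - Inf K))"
  proof (rule sum_mono2[OF fin])
    show "0 \<le> (case tK of (t, K) \<Rightarrow> (M + e1) * (Sup K - Inf K))" if "tK \<in> p - (p - p1)" for tK
      using that \<open>0 \<le> M\<close> e1(1) by (cases tK) (auto dest!: pK)
  qed auto
  also have "(\<Sum>(t, K)\<in>p. (M + e1) * (Sup K - Inf K)) = (M + e1) * (b - a)"
    unfolding len[symmetric] by (simp add: sum_distrib_left case_prod_unfold)
  also have "(M + e1) * (b - a) + e1 = M * (b - a) + e"
    using e1(2) by (simp add: algebra_simps)
  finally show "norm (F b - F a) \<le> M * (b - a) + e"
    by simp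
qed

section \<open>Projected dynamics on the nonnegative orthant\<close>

text \<open>The Euclidean distance grows with each coordinate distance, so the minimisation splits
  into one-dimensional problems, each solved by truncation at 0.\<close>

lemma closest_point_nonneg_orthant:
  fixes z :: "real ^ 'n"
  shows "closest_point nonneg_orthant z = (\<chi> k. max 0 (z $ k))"
proof (rule closest_point_unique[symmetric])
  have eq: "nonneg_orthant = {x :: real ^ 'n. \<forall>k. 0 \<le> x $ k}"
    by (auto simp: nonneg_orthant_def less_eq_vec_def)
  show "convex (nonneg_orthant :: (real ^ 'n) set)"
    unfolding eq convex_def by auto
  show "closed (nonneg_orthant :: (real ^ 'n) set)"
    unfolding eq by (intro closed_Collect_all closed_Collect_le continuous_intros)
  show "(\<chi> k. max 0 (z $ k)) \<in> nonneg_orthant"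
    by (simp add: eq)
  show "\<forall>w\<in>nonneg_orthant. dist z (\<chi> k. max 0 (z $ k)) \<le> dist z w"
    unfolding dist_norm
  proof
    fix w :: "real ^ 'n"
    assume "w \<in> nonneg_orthant"
    then have "0 \<le> w $ k" for k
      by (simp add: eq)
    then have "\<bar>z $ k - max 0 (z $ k)\<bar> \<le> \<bar>z $ k - w $ k\<bar>" for k
      by (smt (verit))
    then show "norm (z - (\<chi> k. max 0 (z $ k))) \<le> norm (z - w)"
      by (intro norm_le_componentwise_cart) simp
  qed
qed

text \<open>In each coordinate the difference quotient is eventually constant. Hence the limit
  behind \<open>Lim\<close> exists, and it arises from \<open>v\<close> by setting some coordinates
  to 0.\<close>

lemma norm_proj_dir_nonneg_orthant_le:
  fixes x v :: "real ^ 'n"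
  assumes "x \<in> nonneg_orthant"
  shows "norm (proj_dir nonneg_orthant x v) \<le> norm v"
proof -
  have x: "0 \<le> x $ k" for k
    using assms by (simp add: nonneg_orthant_def less_eq_vec_def)
  \<comment> \<open>At a zero coordinate the truncation removes a negative direction; at a positive
    one it is inactive for small steps.\<close>
  define w where "w = (\<chi> k. if x $ k = 0 then max 0 (v $ k) else v $ k)"
  have "((\<lambda>\<xi>. (closest_point nonneg_orthant (x + \<xi> *\<^sub>R v) - x) /\<^sub>R \<xi>) \<longlongrightarrow> w) (at_right 0)"
  proof (rule vec_tendstoI, rule tendsto_eventually)
    fix k
    have small: "\<forall>\<^sub>F \<xi> in at_right 0. x $ k = 0 \<or> 0 < x $ k + \<xi> * v $ k"
    proof (cases "x $ k = 0")
      case False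
      have "((\<lambda>\<xi>. x $ k + \<xi> * v $ k) \<longlongrightarrow> x $ k + 0 * v $ k) (at_right 0)"
        by (intro tendsto_intros)
      then have "\<forall>\<^sub>F \<xi> in at_right 0. 0 < x $ k + \<xi> * v $ k"
        using False x[of k] by (intro order_tendstoD) auto
      then show ?thesis
        by (rule eventually_mono) simp
    qed simp
    show "\<forall>\<^sub>F \<xi> in at_right 0.
        ((closest_point nonneg_orthant (x + \<xi> *\<^sub>R v) - x) /\<^sub>R \<xi>) $ k = w $ k"
      using small eventually_at_right_less[of 0]
      by eventually_elim
        (auto simp: closest_point_nonneg_orthant w_def max_def mult_less_0_iff zero_le_mult_iff)
  qed
  then have "proj_dir nonneg_orthant x v = w"
    unfolding proj_dir_def by (intro tendsto_Lim) auto
  moreover have "norm w \<le> norm v"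
    by (rule norm_le_componentwise_cart) (auto simp: w_def)
  ultimately show ?thesis
    by simp
qed

text \<open>A crude bound through the 1-norm suffices: what matters is that it does not depend on
  the broadcast values.\<close>

lemma norm_sgn_vec_le:
  fixes z :: "real ^ 'n"
  shows "norm (sgn_vec z) \<le> CARD('n)"
proof -
  have "norm (sgn_vec z) \<le> (\<Sum>k\<in>UNIV. \<bar>sgn_vec z $ k\<bar>)"
    by (rule norm_le_l1_cart)
  also have "\<dots> \<le> (\<Sum>k\<in>(UNIV::'n set). 1)"
    by (rule sum_mono) (simp add: sgn_vec_def sgn_if)
  finally show ?thesis
    by simp
qed

section \<open>Error at a trigger, and right continuity\<close>

text \<open>The disagreement term is nonnegative and is dropped; the remaining threshold depends on
  time only.\<close>

lemma triggered_imp_norm_ge: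
  fixes \<mu> :: "'v::finite \<Rightarrow> real \<Rightarrow> real ^ 'q"
  assumes "triggered E K\<mu> \<sigma> \<iota> \<mu> \<mu>hat i m t"
  shows "\<sigma> * exp (- \<iota> * t) / (3 * (real CARD('v))\<^sup>2 * K\<mu> * sqrt (real CARD('q)))
    \<le> norm (m - \<mu> i t)"
proof -
  have "0 \<le> (\<Sum>j\<in>UNIV. adjacency E i j * norm1 (m - \<mu>hat j t))"
    by (intro sum_nonneg mult_nonneg_nonneg) (auto simp: adjacency_def norm1_def sum_nonneg)
  then have "0 \<le> 1 / (6 * real CARD('v) * sqrt (real CARD('q))) *
      (\<Sum>j\<in>UNIV. adjacency E i j * norm1 (m - \<mu>hat j t))"
    by (intro mult_nonneg_nonneg) auto
  then show ?thesis
    using assms unfolding triggered_def by linarith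
qed

text \<open>Absolute continuity is tested on the single interval \<open>{a..t}\<close>. This serves
  at the horizon, beyond which no derivative bound is at hand.\<close>

lemma abs_continuous_on_right_limit:
  assumes "abs_continuous_on {a..b} F" "a < b" "e > 0"
  obtains d where "d > 0" "\<And>t. \<lbrakk>t \<in> {a..b}; t < a + d\<rbrakk> \<Longrightarrow> norm (F t - F a) < e"
proof -
  obtain d where "d > 0" and d: "\<And>\<D>. \<lbrakk>\<D> division_of \<Union>\<D>; \<Union>\<D> \<subseteq> {a..b};
      (\<Sum>K\<in>\<D>. Sup K - Inf K) < d\<rbrakk> \<Longrightarrow> (\<Sum>K\<in>\<D>. norm (F (Sup K) - F (Inf K))) < e"
    using assms unfolding abs_continuous_on_def by meson
  have "norm (F t - F a) < e" if "t \<in> {a..b}" "t < a + d" for t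
    using d[of "{{a..t}}"] that division_of_self[of a t] by simp
  then show thesis
    using that \<open>d > 0\<close> by blast
qed

section \<open>Separation of the communication instants up to the horizon\<close>

theorem theorem5:
  fixes S :: "'v::finite \<Rightarrow> 'n::finite set"
    and U :: "'v \<Rightarrow> 'm::finite set"
    and P :: "'v \<Rightarrow> 'p::finite set"
    and A :: "'v \<Rightarrow> real ^ 'n ^ 'n"
    and B :: "'v \<Rightarrow> real ^ 'm ^ 'n"
    and C :: "'v \<Rightarrow> real ^ 'n ^ 'p"
    and K\<alpha> :: "'v \<Rightarrow> real ^ 'n ^ 'm"
    and K\<beta> :: "'v \<Rightarrow> real ^ 'p ^ 'm"
    and E :: "('v \<times> 'v) set"
    and Y :: "'v \<Rightarrow> (real ^ 'p) set"
    and f :: "'v \<Rightarrow> real \<Rightarrow> real ^ 'p \<Rightarrow> real"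
    and g :: "'v \<Rightarrow> real \<Rightarrow> real ^ 'p \<Rightarrow> real ^ 'q::finite"
    and Kf Kg \<epsilon> K\<mu> \<sigma> \<iota> T :: real
    and J :: "real set"
    and x :: "'v \<Rightarrow> real \<Rightarrow> real ^ 'n"
    and u :: "'v \<Rightarrow> real \<Rightarrow> real ^ 'm"
    and y :: "'v \<Rightarrow> real \<Rightarrow> real ^ 'p"
    and H :: "'v \<Rightarrow> real \<Rightarrow> real ^ 'p"
    and \<mu> \<mu>hat :: "'v \<Rightarrow> real \<Rightarrow> real ^ 'q"
    and \<tau> :: "'v \<Rightarrow> nat \<Rightarrow> ereal"
  assumes horizon: "T > 0"
    and matrices: "\<And>i. A i \<in> coord_matrices (S i) (S i)"
      "\<And>i. B i \<in> coord_matrices (S i) (U i)"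
      "\<And>i. C i \<in> coord_matrices (P i) (S i)"
    and graph: "sym E" "irrefl E" "\<And>i j. (i, j) \<in> E\<^sup>*"
    and output_sets: "\<And>i. Y i \<subseteq> coord_space (P i)" "\<And>i. convex (Y i)" "\<And>i. compact (Y i)"
    and convexity: "\<And>i t. t \<in> {0..T} \<Longrightarrow> convex_on (Y i) (f i t)"
      "\<And>i t k. t \<in> {0..T} \<Longrightarrow> convex_on (Y i) (\<lambda>z. g i t z $ k)"
    and bounds: "Kf > 0" "Kg > 0"
      "\<And>i t z. t \<in> {0..T} \<Longrightarrow> z \<in> Y i \<Longrightarrow> \<bar>f i t z\<bar> \<le> Kf"
      "\<And>i t z. t \<in> {0..T} \<Longrightarrow> z \<in> Y i \<Longrightarrow> norm (g i t z) \<le> Kg"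
    and integrability:
      "\<And>i z. z \<in> Y i \<Longrightarrow> (\<lambda>t. f i t z) absolutely_integrable_on {0..T}"
      "\<And>i z. z \<in> Y i \<Longrightarrow> (\<lambda>t. g i t z) absolutely_integrable_on {0..T}"
      "\<And>i. (\<lambda>t. f i t (y i t)) absolutely_integrable_on ({0..T} \<inter> J)"
      "\<And>i. (\<lambda>t. g i t (y i t)) absolutely_integrable_on ({0..T} \<inter> J)"
    and feasible:
      "\<exists>z. (\<forall>i. z i \<in> Y i) \<and> (\<forall>t\<in>{0..T}. (\<Sum>i\<in>UNIV. g i t (z i)) \<le> 0)"
    and controllability: "\<And>i. controllable (S i) (U i) (A i) (B i)"
      "\<And>i. rank (C i ** B i) = card (P i)"
    and feedback: "\<And>i. K\<alpha> i \<in> coord_matrices (U i) (S i)"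
      "\<And>i. K\<beta> i \<in> coord_matrices (U i) (P i)"
      "\<And>i. C i ** B i ** K\<alpha> i = C i ** A i"
      "\<And>i. C i ** B i ** K\<beta> i = coord_identity (P i)"
    and parameters: "\<epsilon> > 0" "K\<mu> > 0" "\<sigma> > 0" "\<iota> > 0"
    and time_domain: "is_interval J" "0 \<in> J" "J \<subseteq> {0..}"
    and regularity: "\<And>i. locally_abs_continuous_on J (x i)"
      "\<And>i. locally_abs_continuous_on J (\<mu> i)"
    and constraints: "\<And>i t. t \<in> J \<Longrightarrow> x i t \<in> coord_space (S i)"
      "\<And>i t. t \<in> J \<Longrightarrow> y i t \<in> Y i"
      "\<And>i t. t \<in> J \<Longrightarrow> \<mu> i t \<in> nonneg_orthant"
    and agent_output: "\<And>i t. t \<in> J \<Longrightarrow> y i t = C i *v x i t"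
    and dynamics: "\<And>i. AE t in lebesgue. t \<in> J \<longrightarrow>
      (x i has_vector_derivative A i *v x i t + B i *v u i t) (at t within J)"
    and subgradient: "\<And>i. AE t in lebesgue. t \<in> J \<longrightarrow>
      H i t \<in> lagrangian_subgradients (P i) (Y i) (f i t) (g i t) (y i t) (\<mu> i t)"
    and controller: "\<And>i. AE t in lebesgue. t \<in> J \<longrightarrow>
      u i t = - (K\<alpha> i *v x i t) + K\<beta> i *v proj_dir (Y i) (y i t) (- \<epsilon> *\<^sub>R H i t)"
    and multiplier: "\<And>i. AE t in lebesgue. t \<in> J \<longrightarrow>
      (\<mu> i has_vector_derivative
        proj_dir nonneg_orthant (\<mu> i t)
          (\<epsilon> *\<^sub>R g i t (y i t) -
           (2 * \<epsilon> * K\<mu>) *\<^sub>R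
             (\<Sum>j\<in>UNIV. adjacency E i j *\<^sub>R sgn_vec (\<mu>hat i t - \<mu>hat j t))))
        (at t within J)"
    and multiplier_init: "\<And>i. \<mu> i 0 = 0"
    and communication: "event_triggered J E K\<mu> \<sigma> \<iota> \<mu> \<mu>hat \<tau>"
  shows "\<forall>i. finite {l. \<tau> i l \<le> ereal T}"
proof
  fix i
  \<comment> \<open>\<open>M\<close> bounds the speed of the multiplier: at most
    \<open>CARD('v)\<close> sign vectors enter, each of norm at most \<open>CARD('q)\<close>. The
    time-dependent part of the threshold is \<open>c * exp (- \<iota> * t)\<close>, smallest on
    \<open>{0..T}\<close> at \<open>T\<close>; \<open>\<delta>\<close> is the time needed to build
    up that error at speed \<open>M\<close>.\<close>
  define M where "M = \<epsilon> * Kg + 2 * \<epsilon> * K\<mu> * (real CARD('v) * real CARD('q))"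
  define c where "c = \<sigma> / (3 * (real CARD('v))\<^sup>2 * K\<mu> * sqrt (real CARD('q)))"
  define \<delta> where "\<delta> = c * exp (- \<iota> * T) / M"
  have "M > 0"
    using parameters bounds unfolding M_def by (intro add_pos_pos mult_pos_pos) auto
  have "c > 0"
    using parameters unfolding c_def by (intro divide_pos_pos mult_pos_pos) auto
  have "\<delta> > 0"
    using \<open>M > 0\<close> \<open>c > 0\<close> by (simp add: \<delta>_def)
  have sub_J: "{s..t} \<subseteq> J" if "s \<in> J" "t \<in> J" for s t
    by (meson atLeastAtMost_iff mem_is_interval_1_I subsetI that time_domain(1))
  have deriv: "norm (proj_dir nonneg_orthant (\<mu> i t) (\<epsilon> *\<^sub>R g i t (y i t) -
      (2 * \<epsilon> * K\<mu>) *\<^sub>R (\<Sum>j\<in>UNIV. adjacency E i j *\<^sub>R sgn_vec (\<mu>hat i t - \<mu>hat j t)))) \<le> M"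
    (is "norm (proj_dir _ _ (?G - _ *\<^sub>R ?s)) \<le> M") if "t \<in> J" "t \<le> T" for t
  proof -
    have "t \<in> {0..T}"
      using that time_domain(3) by auto
    have "norm ?s \<le> (\<Sum>j\<in>(UNIV::'v set). real CARD('q))"
      by (rule sum_norm_le) (use norm_sgn_vec_le in \<open>auto simp: adjacency_def\<close>)
    then have "norm ?s \<le> real CARD('v) * real CARD('q)"
      by simp
    then have s: "2 * \<epsilon> * K\<mu> * norm ?s \<le> 2 * \<epsilon> * K\<mu> * (real CARD('v) * real CARD('q))"
      using parameters by (intro mult_left_mono) auto
    have "norm (g i t (y i t)) \<le> Kg"
      using bounds(4) \<open>t \<in> {0..T}\<close> constraints(2) that by blast
    then have "norm ?G \<le> \<epsilon> * Kg"
      using parameters by (simp add: mult_left_mono)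
    then have "norm (?G - (2 * \<epsilon> * K\<mu>) *\<^sub>R ?s) \<le> M"
      using s parameters norm_triangle_ineq4[of ?G "(2 * \<epsilon> * K\<mu>) *\<^sub>R ?s"]
      unfolding M_def norm_scaleR by (simp only: abs_of_pos mult_pos_pos zero_less_numeral)
    then show ?thesis
      using norm_proj_dir_nonneg_orthant_le[OF constraints(3)[OF \<open>t \<in> J\<close>]] order_trans by blast
  qed
  have lipschitz: "norm (\<mu> i t - \<mu> i s) \<le> M * (t - s)" if "s \<in> J" "t \<in> J" "s \<le> t" "t \<le> T" for s t
  proof (rule abs_continuous_imp_norm_diff_le)
    show "abs_continuous_on {s..t} (\<mu> i)"
      using regularity(2) sub_J that unfolding locally_abs_continuous_on_def by blast
    show "AE r in lebesgue. r \<in> {s..t} \<longrightarrow>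
        (\<exists>D. (\<mu> i has_vector_derivative D) (at r within {s..t}) \<and> norm D \<le> M)"
      using multiplier[of i]
    proof (rule eventually_mono, intro impI)
      fix r
      assume der: "r \<in> J \<longrightarrow> (\<mu> i has_vector_derivative proj_dir nonneg_orthant (\<mu> i r)
          (\<epsilon> *\<^sub>R g i r (y i r) - (2 * \<epsilon> * K\<mu>) *\<^sub>R
            (\<Sum>j\<in>UNIV. adjacency E i j *\<^sub>R sgn_vec (\<mu>hat i r - \<mu>hat j r)))) (at r within J)"
        and r: "r \<in> {s..t}"
      have "r \<in> J" "r \<le> T"
        using r sub_J[OF that(1,2)] that(4) by auto
      then show "\<exists>D. (\<mu> i has_vector_derivative D) (at r within {s..t}) \<and> norm D \<le> M"
        using der deriv has_vector_derivative_within_subset sub_J[OF that(1,2)] by blast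
    qed
  qed (use that \<open>M > 0\<close> in auto)
  have trigger: "c * exp (- \<iota> * t) \<le> norm (\<mu> i s - \<mu> i t)"
    if "triggered E K\<mu> \<sigma> \<iota> \<mu> \<mu>hat i (\<mu> i s) t" for s t
    using triggered_imp_norm_ge[OF that] by (simp add: c_def)
  have \<tau>_0: "\<tau> i 0 = 0"
    using communication unfolding event_triggered_def by blast
  have \<tau>_Suc: "\<tau> i (Suc l) = Inf {ereal t | t. t \<in> J \<and> \<tau> i l < ereal t \<and>
      triggered E K\<mu> \<sigma> \<iota> \<mu> \<mu>hat i (\<mu> i (real_of_ereal (\<tau> i l))) t}" for l
    using communication unfolding event_triggered_def by blast
  have "\<tau> i l \<le> \<tau> i (Suc l)" for l
    unfolding \<tau>_Suc by (intro Inf_greatest) auto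
  then have mono: "\<tau> i l \<le> \<tau> i k" if "l \<le> k" for l k
    using lift_Suc_mono_le that by blast
  \<comment> \<open>The cap at \<open>T\<close> reflects that the Lipschitz bound ends there: a
    candidate beyond \<open>T\<close> satisfies the inequality trivially.\<close>
  have lower: "ereal (min (real l * \<delta>) T) \<le> \<tau> i l" for l
  proof (induction l)
    case 0
    then show ?case
      using horizon \<tau>_0 by simp
  next
    case (Suc l)
    show ?case
      unfolding \<tau>_Suc
    \<comment> \<open>Every candidate is bounded, so the argument covers an infimum that is not
      attained and the value \<open>\<infinity>\<close> for an empty set.\<close>
    proof (rule Inf_greatest, clarify)
      fix t
      assume t: "t \<in> J" "\<tau> i l < ereal t"
        and trig: "triggered E K\<mu> \<sigma> \<iota> \<mu> \<mu>hat i (\<mu> i (real_of_ereal (\<tau> i l))) t"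
      have "0 \<le> \<tau> i l"
        using mono[of 0 l] \<tau>_0 by simp
      then obtain s where s: "\<tau> i l = ereal s" "0 \<le> s" "s < t"
        using t(2) by (cases "\<tau> i l") auto
      have "s \<in> J"
        using sub_J[OF time_domain(2) t(1)] s by auto
      show "ereal (min (real (Suc l) * \<delta>) T) \<le> ereal t"
      proof (cases "t \<le> T")
        case True
        have "c * exp (- \<iota> * T) \<le> c * exp (- \<iota> * t)"
          using True parameters \<open>c > 0\<close> by simp
        also have "\<dots> \<le> norm (\<mu> i s - \<mu> i t)"
          using trigger trig s by simp
        also have "\<dots> \<le> M * (t - s)"
          using lipschitz[OF \<open>s \<in> J\<close> t(1)] s True by (simp add: norm_minus_commute)
        finally have "\<delta> \<le> t - s"
          using \<open>M > 0\<close> by (simp add: \<delta>_def divide_le_eq mult.commute)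
        moreover have "min (real l * \<delta>) T \<le> s"
          using Suc s(1) unfolding ereal_less_eq(3)[symmetric] by simp
        ultimately show ?thesis
          using \<open>\<delta> > 0\<close> by (auto simp: algebra_simps min_le_iff_disj)
      qed (simp add: min_le_iff_disj)
    qed
  qed
  show "finite {l. \<tau> i l \<le> ereal T}"
  proof (rule ccontr)
    assume inf: "infinite {l. \<tau> i l \<le> ereal T}"
    have all: "\<tau> i l \<le> ereal T" for l
      using inf mono[of l] unfolding infinite_nat_iff_unbounded_le by (metis mem_Collect_eq order_trans)
    \<comment> \<open>From this index on, the lower bound equals \<open>T\<close>, so infinitely
      many instants up to \<open>T\<close> would all have to coincide with \<open>T\<close>.\<close>
    obtain l where "T / \<delta> \<le> real l"
      using real_arch_simple by blast
    then have "min (real l * \<delta>) T = T"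
      using \<open>\<delta> > 0\<close> by (simp add: divide_le_eq)
    then have \<tau>_T: "\<tau> i l = ereal T" "\<tau> i (Suc l) = ereal T"
      using lower[of l] all mono[of l "Suc l"] by (metis le_SucI order_antisym order_refl order_trans)+
    \<comment> \<open>The candidates exceed \<open>\<tau> i l = T\<close> strictly while their
      infimum is \<open>T\<close>, so triggers occur arbitrarily close to \<open>T\<close> from the
      right, all with the same broadcast value \<open>\<mu> i T\<close>.\<close>
    have after: "\<exists>t\<in>J. T < t \<and> t < r \<and> triggered E K\<mu> \<sigma> \<iota> \<mu> \<mu>hat i (\<mu> i T) t" if "T < r" for r
    proof -
      have "Inf {ereal t | t. t \<in> J \<and> \<tau> i l < ereal t \<and>
          triggered E K\<mu> \<sigma> \<iota> \<mu> \<mu>hat i (\<mu> i (real_of_ereal (\<tau> i l))) t} < ereal r"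
        using that \<tau>_T(2) unfolding \<tau>_Suc by (metis less_ereal.simps(1))
      then show ?thesis
        using \<tau>_T(1) unfolding Inf_less_iff by auto
    qed
    \<comment> \<open>A point of the time domain beyond \<open>T\<close>; up to \<open>b\<close> the
      threshold stays above the fixed positive value \<open>c * exp (- \<iota> * b)\<close>.\<close>
    obtain b where b: "b \<in> J" "T < b"
      using after[of "T + 1"] by auto
    have "T \<in> J"
      using sub_J[OF time_domain(2) b(1)] b(2) horizon by auto
    then have "abs_continuous_on {T..b} (\<mu> i)"
      using regularity(2) sub_J b unfolding locally_abs_continuous_on_def by blast
    then obtain d where "d > 0"
      and d: "\<And>t. \<lbrakk>t \<in> {T..b}; t < T + d\<rbrakk> \<Longrightarrow> norm (\<mu> i t - \<mu> i T) < c * exp (- \<iota> * b)"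
      using abs_continuous_on_right_limit[of T b "\<mu> i" "c * exp (- \<iota> * b)"] b(2) \<open>c > 0\<close>
      by (metis exp_gt_zero mult_pos_pos)
    obtain t where t: "t \<in> J" "T < t" "t < min b (T + d)"
      "triggered E K\<mu> \<sigma> \<iota> \<mu> \<mu>hat i (\<mu> i T) t"
      using after[of "min b (T + d)"] b \<open>d > 0\<close> by auto
    \<comment> \<open>A trigger this close to \<open>T\<close> requires an error that right
      continuity at \<open>T\<close> rules out.\<close>
    have "c * exp (- \<iota> * b) \<le> c * exp (- \<iota> * t)"
      using t(3) parameters \<open>c > 0\<close> by simp
    also have "\<dots> \<le> norm (\<mu> i t - \<mu> i T)"
      using trigger[OF t(4)] by (simp add: norm_minus_commute)
    also have "\<dots> < c * exp (- \<iota> * b)"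
      using d t(2,3) by simp
    finally show False
      by simp
  qed
qed

end
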